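(* Let $(\mathfrak{h},\{~,~\})$ be a Leibniz algebra, $(V,\rho^L,\rho^R)$ a representation of it, and $P:V\rightarrow\mathfrak{h}$ a relative averaging operator. Then $V$ inherits a di-Leibniz algebra structure with the operations $$\{u,v\}_{\dashv}^P := \rho^R(u,P(v))\quad\text{and}\quad\{u,v\}_{\vdash}^P := \rho^L(P(u),v),\quad\text{for } u,v\in V.$$
   Context: All vector spaces are over a fixed field. A (left) Leibniz algebra is a vector space $\mathfrak{h}$ with a bilinear bracket satisfying $\{x,\{y,z\}\} = \{\{x,y\},z\}+\{y,\{x,z\}\}$ for all $x,y,z$. A representation of $\mathfrak{h}$ is a vector space $V$ with bilinear maps $\rho^L:\mathfrak{h}\times V\to V$, $\rho^R:V\times\mathfrak{h}\to V$ satisfying, for $x,y\in\mathfrak{h}$, $v\in V$: $\rho^L(x,\rho^L(y,v)) = \rho^L(\{x,y\},v)+\rho^L(y,\rho^L(x,v))$; $\rho^L(x,\rho^R(v,y)) = \rho^R(\rho^L(x,v),y)+\rho^R(v,\{x,y\})$; $\rho^R(v,\{x,y\}) = \rho^R(\rho^R(v,x),y)+\rho^L(x,\rho^R(v,y))$. A relative averaging operator on $\mathfrak{h}$ with respect to $V$ is a linear map $P:V\to\mathfrak{h}$ satisfying $\{P(u),P(v)\} = P(\rho^L(P(u),v)) = P(\rho^R(u,P(v)))$ for all $u,v\in V$. A (left) di-Leibniz algebra is a vector space $\mathfrak{d}$ with two bilinear maps $\{~,~\}_\dashv,\{~,~\}_\vdash:\mathfrak{d}\times\mathfrak{d}\to\mathfrak{d}$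 satisfying for all $x,y,z\in\mathfrak{d}$: (1) $\{x,\{y,z\}_\dashv\}_\dashv = \{\{x,y\}_\dashv,z\}_\dashv+\{y,\{x,z\}_\dashv\}_\vdash$; (2) $\{x,\{y,z\}_\vdash\}_\dashv = \{\{x,y\}_\dashv,z\}_\dashv+\{y,\{x,z\}_\dashv\}_\vdash$; (3) $\{x,\{y,z\}_\dashv\}_\vdash = \{\{x,y\}_\vdash,z\}_\dashv+\{y,\{x,z\}_\dashv\}_\dashv$; (4) $\{x,\{y,z\}_\vdash\}_\vdash = \{\{x,y\}_\dashv,z\}_\vdash+\{y,\{x,z\}_\vdash\}_\vdash$; (5) $\{x,\{y,z\}_\vdash\}_\vdash = \{\{x,y\}_\vdash,z\}_\vdash+\{y,\{x,z\}_\vdash\}_\vdash$. *)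

theory Defs
  imports Complex_Main
begin

text \<open>
  Vector spaces are the library's \<^locale>\<open>vector_space\<close>: all elements of an abelian group type,
  with an explicit scalar multiplication by an arbitrary field.
\<close>

definition bilinear_map ::
  "('k::field \<Rightarrow> 'a::ab_group_add \<Rightarrow> 'a) \<Rightarrow> ('k \<Rightarrow> 'b::ab_group_add \<Rightarrow> 'b) \<Rightarrow>
   ('k \<Rightarrow> 'c::ab_group_add \<Rightarrow> 'c) \<Rightarrow> ('a \<Rightarrow> 'b \<Rightarrow> 'c) \<Rightarrow> bool"
  where "bilinear_map sA sB sC f \<longleftrightarrow>
    (\<forall>x. Vector_Spaces.linear sB sC (\<lambda>y. f x y)) \<and>
    (\<forall>y. Vector_Spaces.linear sA sC (\<lambda>x. f x y))"

locale leibniz_algebra = H: vector_space scaleH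
  for scaleH :: "'k::field \<Rightarrow> 'h::ab_group_add \<Rightarrow> 'h" +
  fixes bracket :: "'h \<Rightarrow> 'h \<Rightarrow> 'h"
  assumes bilinear_bracket: "bilinear_map scaleH scaleH scaleH bracket"
    and leibniz: "bracket x (bracket y z) = bracket (bracket x y) z + bracket y (bracket x z)"

locale leibniz_representation =
  leibniz_algebra scaleH bracket + V: vector_space scaleV
  for scaleH :: "'k::field \<Rightarrow> 'h::ab_group_add \<Rightarrow> 'h"
    and bracket :: "'h \<Rightarrow> 'h \<Rightarrow> 'h"
    and scaleV :: "'k \<Rightarrow> 'v::ab_group_add \<Rightarrow> 'v" +
  fixes rhoL :: "'h \<Rightarrow> 'v \<Rightarrow> 'v"
    and rhoR :: "'v \<Rightarrow> 'h \<Rightarrow> 'v"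
  assumes bilinear_rhoL: "bilinear_map scaleH scaleV scaleV rhoL"
    and bilinear_rhoR: "bilinear_map scaleV scaleH scaleV rhoR"
    and rhoL_rhoL: "rhoL x (rhoL y v) = rhoL (bracket x y) v + rhoL y (rhoL x v)"
    and rhoL_rhoR: "rhoL x (rhoR v y) = rhoR (rhoL x v) y + rhoR v (bracket x y)"
    and rhoR_bracket: "rhoR v (bracket x y) = rhoR (rhoR v x) y + rhoL x (rhoR v y)"

locale relative_averaging_operator =
  leibniz_representation scaleH bracket scaleV rhoL rhoR
  for scaleH :: "'k::field \<Rightarrow> 'h::ab_group_add \<Rightarrow> 'h"
    and bracket :: "'h \<Rightarrow> 'h \<Rightarrow> 'h"
    and scaleV :: "'k \<Rightarrow> 'v::ab_group_add \<Rightarrow> 'v"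
    and rhoL :: "'h \<Rightarrow> 'v \<Rightarrow> 'v"
    and rhoR :: "'v \<Rightarrow> 'h \<Rightarrow> 'v" +
  fixes P :: "'v \<Rightarrow> 'h"
  assumes linear_P: "Vector_Spaces.linear scaleV scaleH P"
    and averaging_L: "bracket (P u) (P v) = P (rhoL (P u) v)"
    and averaging_R: "bracket (P u) (P v) = P (rhoR u (P v))"

locale di_leibniz_algebra = D: vector_space scaleD
  for scaleD :: "'k::field \<Rightarrow> 'd::ab_group_add \<Rightarrow> 'd" +
  fixes dashv :: "'d \<Rightarrow> 'd \<Rightarrow> 'd"  (infixl "\<stileturn>" 70)
    and vdash :: "'d \<Rightarrow> 'd \<Rightarrow> 'd"  (infixl "\<turnstile>" 70)
  assumes bilinear_dashv: "bilinear_map scaleD scaleD scaleD (\<stileturn>)"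
    and bilinear_vdash: "bilinear_map scaleD scaleD scaleD (\<turnstile>)"
    and di_leibniz1: "x \<stileturn> (y \<stileturn> z) = (x \<stileturn> y) \<stileturn> z + y \<turnstile> (x \<stileturn> z)"
    and di_leibniz2: "x \<stileturn> (y \<turnstile> z) = (x \<stileturn> y) \<stileturn> z + y \<turnstile> (x \<stileturn> z)"
    and di_leibniz3: "x \<turnstile> (y \<stileturn> z) = (x \<turnstile> y) \<stileturn> z + y \<stileturn> (x \<stileturn> z)"
    and di_leibniz4: "x \<turnstile> (y \<turnstile> z) = (x \<stileturn> y) \<turnstile> z + y \<turnstile> (x \<turnstile> z)"
    and di_leibniz5: "x \<turnstile> (y \<turnstile> z) = (x \<turnstile> y) \<turnstile> z + y \<turnstile> (x \<turnstile> z)"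

end

theory Submission
  imports Defs
begin

text \<open>\<open>P\<close> sends both products of \<open>u\<close> and \<open>v\<close> to
  \<open>bracket (P u) (P v)\<close>. In each di-Leibniz identity one of the three elements stays a
  vector and the other two act through \<open>P\<close>; a product in the acting slot thus becomes a
  bracket. The five identities collapse to the three representation axioms
  \<open>rhoR_bracket\<close>, \<open>rhoL_rhoR\<close> and \<open>rhoL_rhoL\<close>, taken at
  values of \<open>P\<close>. Bilinearity survives precomposing one argument with the linear map
  \<open>P\<close>.\<close>

lemma bilinear_map_compose_left:
  assumes f: "bilinear_map sB sC sD f" and g: "Vector_Spaces.linear sA sB g"
  shows "bilinear_map sA sC sD (\<lambda>x y. f (g x) y)"
  using f Vector_Spaces.linear_compose[OF g]
  by (auto simp: bilinear_map_def comp_def)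

lemma bilinear_map_compose_right:
  assumes f: "bilinear_map sA sC sD f" and g: "Vector_Spaces.linear sB sC g"
  shows "bilinear_map sA sB sD (\<lambda>x y. f x (g y))"
  using f Vector_Spaces.linear_compose[OF g]
  by (auto simp: bilinear_map_def comp_def)

theorem proposition6p14:
  fixes scaleH :: "'k::field \<Rightarrow> 'h::ab_group_add \<Rightarrow> 'h"
    and bracket :: "'h \<Rightarrow> 'h \<Rightarrow> 'h"
    and scaleV :: "'k \<Rightarrow> 'v::ab_group_add \<Rightarrow> 'v"
    and rhoL :: "'h \<Rightarrow> 'v \<Rightarrow> 'v"
    and rhoR :: "'v \<Rightarrow> 'h \<Rightarrow> 'v"
    and P :: "'v \<Rightarrow> 'h"
  assumes "leibniz_algebra scaleH bracket"
    and "leibniz_representation scaleH bracket scaleV rhoL rhoR"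
    and "relative_averaging_operator scaleH bracket scaleV rhoL rhoR P"
  shows "di_leibniz_algebra scaleV (\<lambda>u v. rhoR u (P v)) (\<lambda>u v. rhoL (P u) v)"
proof -
  interpret relative_averaging_operator scaleH bracket scaleV rhoL rhoR P
    by fact
  \<comment> \<open>Oriented to turn \<open>P\<close> of a product into a bracket, the form in which
    the representation axioms apply.\<close>
  note P_rhoL = averaging_L[symmetric] and P_rhoR = averaging_R[symmetric]
  show ?thesis
  proof
    show "bilinear_map scaleV scaleV scaleV (\<lambda>u v. rhoR u (P v))"
      using bilinear_rhoR linear_P by (rule bilinear_map_compose_right)
    show "bilinear_map scaleV scaleV scaleV (\<lambda>u v. rhoL (P u) v)"
      using bilinear_rhoL linear_P by (rule bilinear_map_compose_left)
  next
    fix x y z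
    show "rhoR x (P (rhoR y (P z))) = rhoR (rhoR x (P y)) (P z) + rhoL (P y) (rhoR x (P z))"
      unfolding P_rhoR by (rule rhoR_bracket)
    \<comment> \<open>Differs from the previous identity only under \<open>P\<close>, which does not
      distinguish the two products.\<close>
    show "rhoR x (P (rhoL (P y) z)) = rhoR (rhoR x (P y)) (P z) + rhoL (P y) (rhoR x (P z))"
      unfolding P_rhoL by (rule rhoR_bracket)
    \<comment> \<open>Here the middle element \<open>y\<close> is the vector, acted on from both
      sides.\<close>
    show "rhoL (P x) (rhoR y (P z)) = rhoR (rhoL (P x) y) (P z) + rhoR y (P (rhoR x (P z)))"
      unfolding P_rhoR by (rule rhoL_rhoR)
    \<comment> \<open>Here and in the last identity \<open>z\<close> is the vector; both reduce to
      the same instance of \<open>rhoL_rhoL\<close>.\<close>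
    show "rhoL (P x) (rhoL (P y) z) = rhoL (P (rhoR x (P y))) z + rhoL (P y) (rhoL (P x) z)"
      unfolding P_rhoR by (rule rhoL_rhoL)
    show "rhoL (P x) (rhoL (P y) z) = rhoL (P (rhoL (P x) y)) z + rhoL (P y) (rhoL (P x) z)"
      unfolding P_rhoL by (rule rhoL_rhoL)
  qed
qed

end
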